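(* $\mathsf{DNR}_k\blacktriangledown\mathsf{DNR}_k<^1_1\mathsf{DNR}_{k^2}$ for any $k\ge2$.
   Context: $\mathsf{DNR}_k$ is the set of all $k$-valued diagonally noncomputable functions, i.e. all total $f:\mathbb N\to\mathbb N$ with $f(n)<k$ for every $n$ and $f(e)\neq\Phi_e(e)$ whenever $\Phi_e(e)$ converges, where $\Phi_e$ is the $e$-th partial computable function on $\mathbb N$. It is a $\Pi^0_1$ subset of $k^{\mathbb N}=\{0,\dots,k-1\}^{\mathbb N}$. For $A,B\subseteq\mathbb N^{\mathbb N}$, $A\le^1_1B$ (Medvedev reducibility) means that there is a partial computable function $\Gamma:\subseteq\mathbb N^{\mathbb N}\to\mathbb N^{\mathbb N}$ defined on all of $B$ with $\Gamma(g)\in A$ for every $g\in B$; $A<^1_1B$ means $A\le^1_1B$ and $B\not\le^1_1A$. With each $\Pi^0_1$ set $P\subseteq k^{\mathbb N}$ (given by an index) a corresponding computable tree $T_P\subseteq k^{<\mathbb N}$ whose set of infinite paths is $P$ is fixed; $L_P$ is the set of leaves (dead ends) of $T_P$. The hyperconcatenation $Q\blacktriangledown P$ is the iterated concatenation of copies of $P$ along the tree $T_Q$: it is the set of infinite paths of the tree of all initial segments of strings of the form $$\rho_0{}^\frown\langle\tau(0)\rangle^\frown\rho_1{}^\frown\langle\tau(1)\rangle^\frown\cdots{}^\frown\rho_{n-1}{}^\frown\langle\tau(n-1)\rangle^\frown\sigma,$$ where $\tau\in T_Q$, $n=|\tau|$, $\rho_0,\dots,\rho_{n-1}\in L_P$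 and $\sigma\in T_P$. *)

theory Defs
  imports Main "HOL-Library.Nat_Bijection" "HOL-Library.Sublist"
begin

section \<open>Partial computable functions with an oracle\<close>

text \<open>
  Programs act on single natural numbers, several arguments being combined by
  \<^const>\<open>prod_encode\<close>. The search operator \<open>Mu c\<close> receives \<open>(x, m)\<close> and looks for the least
  \<open>n \<ge> m\<close> with \<open>c (x, n) = 0\<close>, all values of \<open>c\<close> in between being defined and nonzero;
  ordinary minimization is the case \<open>m = 0\<close>.
\<close>

datatype code =
    Zero | Succ | Left | Right | Oracle
  | Join code code
  | Comp code code
  | PrimRec code code
  | Mu code

inductive runs :: "(nat \<Rightarrow> nat) \<Rightarrow> code \<Rightarrow> nat \<Rightarrow> nat \<Rightarrow> bool" for g :: "nat \<Rightarrow> nat" where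
  Zero: "runs g Zero x 0"
| Succ: "runs g Succ x (Suc x)"
| Left: "runs g Left (prod_encode (x, y)) x"
| Right: "runs g Right (prod_encode (x, y)) y"
| Oracle: "runs g Oracle x (g x)"
| Join: "runs g c x y \<Longrightarrow> runs g d x z \<Longrightarrow> runs g (Join c d) x (prod_encode (y, z))"
| Comp: "runs g d x y \<Longrightarrow> runs g c y z \<Longrightarrow> runs g (Comp c d) x z"
| PrimRec_0: "runs g c x y \<Longrightarrow> runs g (PrimRec c d) (prod_encode (x, 0)) y"
| PrimRec_Suc: "runs g (PrimRec c d) (prod_encode (x, n)) y \<Longrightarrow>
    runs g d (prod_encode (x, prod_encode (n, y))) z \<Longrightarrow>
    runs g (PrimRec c d) (prod_encode (x, Suc n)) z"
| Mu_found: "runs g c (prod_encode (x, m)) 0 \<Longrightarrow> runs g (Mu c) (prod_encode (x, m)) m"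
| Mu_next: "runs g c (prod_encode (x, m)) (Suc y) \<Longrightarrow>
    runs g (Mu c) (prod_encode (x, Suc m)) z \<Longrightarrow>
    runs g (Mu c) (prod_encode (x, m)) z"

inductive_cases runs_ZeroE: "runs g Zero x y"
inductive_cases runs_SuccE: "runs g Succ x y"
inductive_cases runs_LeftE: "runs g Left x y"
inductive_cases runs_RightE: "runs g Right x y"
inductive_cases runs_OracleE: "runs g Oracle x y"
inductive_cases runs_JoinE: "runs g (Join c d) x y"
inductive_cases runs_CompE: "runs g (Comp c d) x y"
inductive_cases runs_PrimRecE: "runs g (PrimRec c d) x y"
inductive_cases runs_MuE: "runs g (Mu c) x y"

lemma runs_deterministic: "runs g c x y \<Longrightarrow> runs g c x z \<Longrightarrow> y = z"
proof (induction arbitrary: z rule: runs.induct)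
  case Zero then show ?case by (auto elim: runs_ZeroE)
next
  case Succ then show ?case by (auto elim: runs_SuccE)
next
  case Left then show ?case by (auto elim: runs_LeftE)
next
  case Right then show ?case by (auto elim: runs_RightE)
next
  case Oracle then show ?case by (auto elim: runs_OracleE)
next
  case Join then show ?case by (blast elim: runs_JoinE)
next
  case Comp then show ?case by (blast elim: runs_CompE)
next
  case (PrimRec_0 c x y d)
  show ?case by (rule runs_PrimRecE[OF PrimRec_0.prems]) (auto dest: PrimRec_0.IH)
next
  case (PrimRec_Suc c d x n y w)
  show ?case by (rule runs_PrimRecE[OF PrimRec_Suc.prems]) (auto dest!: PrimRec_Suc.IH)
next
  case (Mu_found c x m)
  show ?case by (rule runs_MuE[OF Mu_found.prems]) (auto dest: Mu_found.IH)
next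
  case (Mu_next c x m y w)
  show ?case
    by (rule runs_MuE[OF Mu_next.prems]) (use Mu_next.IH in \<open>auto dest: Mu_next.IH(1)\<close>)
qed

text \<open>An effective numbering of all programs; every natural number is an index.\<close>

function code_of :: "nat \<Rightarrow> code" where
  "code_of n =
    (if n = 0 then Zero
     else if n = 1 then Succ
     else if n = 2 then Left
     else if n = 3 then Right
     else if n = 4 then Oracle
     else if (n - 5) mod 4 = 0 then
       Join (code_of (fst (prod_decode ((n - 5) div 4)))) (code_of (snd (prod_decode ((n - 5) div 4))))
     else if (n - 5) mod 4 = 1 then
       Comp (code_of (fst (prod_decode ((n - 5) div 4)))) (code_of (snd (prod_decode ((n - 5) div 4))))
     else if (n - 5) mod 4 = 2 then
       PrimRec (code_of (fst (prod_decode ((n - 5) div 4)))) (code_of (snd (prod_decode ((n - 5) div 4))))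
     else Mu (code_of ((n - 5) div 4)))"
  by pat_completeness auto

lemma fst_prod_decode_le: "fst (prod_decode m) \<le> m"
  using le_prod_encode_1[of "fst (prod_decode m)" "snd (prod_decode m)"] by simp

lemma snd_prod_decode_le: "snd (prod_decode m) \<le> m"
  using le_prod_encode_2[of "snd (prod_decode m)" "fst (prod_decode m)"] by simp

lemma le_div_4_less: "m \<le> (n - 5) div 4 \<Longrightarrow> n \<noteq> 0 \<Longrightarrow> m < (n :: nat)"
  by (cases "n < 5") auto

termination
  by (relation "measure id")
    (auto intro!: le_div_4_less fst_prod_decode_le snd_prod_decode_le)

declare code_of.simps [simp del]

lemma surj_code_of: "surj code_of"
proof -
  have "\<exists>n. code_of n = c" for c
  proof (induction c)
    case Zero then show ?case by (intro exI[of _ 0]) (simp add: code_of.simps)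
  next
    case Succ then show ?case by (intro exI[of _ 1]) (simp add: code_of.simps)
  next
    case Left then show ?case by (intro exI[of _ 2]) (simp add: code_of.simps)
  next
    case Right then show ?case by (intro exI[of _ 3]) (simp add: code_of.simps)
  next
    case Oracle then show ?case by (intro exI[of _ 4]) (simp add: code_of.simps)
  next
    case (Join c d)
    then obtain i j where "code_of i = c" "code_of j = d" by blast
    then show ?case
      by (intro exI[of _ "5 + 4 * prod_encode (i, j)"]) (subst code_of.simps, simp)
  next
    case (Comp c d)
    then obtain i j where "code_of i = c" "code_of j = d" by blast
    moreover have "Suc (4 * m) div 4 = m" "Suc (4 * m) mod 4 = 1" for m :: nat
      by presburger+
    ultimately show ?case
      by (intro exI[of _ "6 + 4 * prod_encode (i, j)"]) (subst code_of.simps, simp)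
  next
    case (PrimRec c d)
    then obtain i j where "code_of i = c" "code_of j = d" by blast
    moreover have "Suc (Suc (4 * m)) div 4 = m" "Suc (Suc (4 * m)) mod 4 = 2" for m :: nat
      by presburger+
    ultimately show ?case
      by (intro exI[of _ "7 + 4 * prod_encode (i, j)"]) (subst code_of.simps, simp)
  next
    case (Mu c)
    then obtain i where "code_of i = c" by blast
    moreover have "(3 + 4 * m) div 4 = m" "(3 + 4 * m) mod 4 = 3" for m :: nat
      by presburger+
    ultimately show ?case
      by (intro exI[of _ "8 + 4 * i"]) (subst code_of.simps, simp)
  qed
  then show ?thesis by (metis surjI surj_def)
qed

definition Phi_oracle :: "nat \<Rightarrow> (nat \<Rightarrow> nat) \<Rightarrow> nat \<rightharpoonup> nat" where
  "Phi_oracle e g x =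
    (if \<exists>y. runs g (code_of e) x y then Some (THE y. runs g (code_of e) x y) else None)"

lemma Phi_oracle_eq_Some_iff: "Phi_oracle e g x = Some y \<longleftrightarrow> runs g (code_of e) x y"
  unfolding Phi_oracle_def by (auto intro: theI runs_deterministic the_equality)

text \<open>Computations without an oracle are those relative to the constant zero function.\<close>

definition Phi :: "nat \<Rightarrow> nat \<rightharpoonup> nat" where
  "Phi e = Phi_oracle e (\<lambda>_. 0)"

definition Phi_functional :: "nat \<Rightarrow> (nat \<Rightarrow> nat) \<rightharpoonup> (nat \<Rightarrow> nat)" where
  "Phi_functional e g =
    (if \<forall>n. Phi_oracle e g n \<noteq> None then Some (\<lambda>n. the (Phi_oracle e g n)) else None)"

definition partial_computable :: "((nat \<Rightarrow> nat) \<rightharpoonup> (nat \<Rightarrow> nat)) \<Rightarrow> bool" where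
  "partial_computable \<Gamma> \<longleftrightarrow> (\<exists>e. \<Gamma> = Phi_functional e)"


section \<open>Medvedev reducibility\<close>

definition medvedev_le :: "(nat \<Rightarrow> nat) set \<Rightarrow> (nat \<Rightarrow> nat) set \<Rightarrow> bool"
    (infix "\<le>\<^sub>M" 50) where
  "A \<le>\<^sub>M B \<longleftrightarrow> (\<exists>\<Gamma>. partial_computable \<Gamma> \<and> (\<forall>g\<in>B. \<exists>h\<in>A. \<Gamma> g = Some h))"

definition medvedev_less :: "(nat \<Rightarrow> nat) set \<Rightarrow> (nat \<Rightarrow> nat) set \<Rightarrow> bool"
    (infix "<\<^sub>M" 50) where
  "A <\<^sub>M B \<longleftrightarrow> A \<le>\<^sub>M B \<and> \<not> B \<le>\<^sub>M A"

definition DNR :: "nat \<Rightarrow> (nat \<Rightarrow> nat) set" where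
  "DNR k = {f. (\<forall>n. f n < k) \<and> (\<forall>e. Phi e e \<noteq> Some (f e))}"


section \<open>Trees and hyperconcatenation\<close>

definition is_tree :: "nat list set \<Rightarrow> bool" where
  "is_tree T \<longleftrightarrow> (\<forall>\<sigma>\<in>T. \<forall>\<tau>. prefix \<tau> \<sigma> \<longrightarrow> \<tau> \<in> T)"

definition computable_strings :: "nat list set \<Rightarrow> bool" where
  "computable_strings T \<longleftrightarrow>
    (\<exists>e. \<forall>\<sigma>. Phi e (list_encode \<sigma>) = Some (if \<sigma> \<in> T then 1 else 0))"

definition paths :: "nat list set \<Rightarrow> (nat \<Rightarrow> nat) set" where
  "paths T = {f. \<forall>n. map f [0..<n] \<in> T}"

definition leaves :: "nat list set \<Rightarrow> nat list set" where
  "leaves T = {\<sigma>\<in>T. \<forall>i. \<sigma> @ [i] \<notin> T}"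

text \<open>
  A \<open>\<Pi>\<^sup>0\<^sub>1\<close> set \<open>P \<subseteq> k\<^sup>\<nat>\<close> has many computable trees \<open>T \<subseteq> k\<^sup><\<^sup>\<nat>\<close> with \<open>P\<close> as set of paths. The
  choice of one of them for each index of \<open>P\<close> is a parameter, since hyperconcatenation depends
  on the leaves and not only on the paths.
\<close>

definition corresponding_tree :: "nat \<Rightarrow> (nat \<Rightarrow> nat) set \<Rightarrow> nat list set \<Rightarrow> bool" where
  "corresponding_tree k P T \<longleftrightarrow>
    is_tree T \<and> T \<subseteq> lists {..<k} \<and> computable_strings T \<and> paths T = P"

definition hyperconcat_tree :: "nat list set \<Rightarrow> nat list set \<Rightarrow> nat list set" where
  "hyperconcat_tree T\<^sub>Q T\<^sub>P =
    {\<mu>. \<exists>\<tau> \<rho>s \<sigma>. \<tau> \<in> T\<^sub>Q \<and> length \<rho>s = length \<tau> \<and> \<rho>s \<in> lists (leaves T\<^sub>P) \<and> \<sigma> \<in> T\<^sub>P \<and>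
      prefix \<mu> (concat (map2 (\<lambda>\<rho> i. \<rho> @ [i]) \<rho>s \<tau>) @ \<sigma>)}"

definition hyperconcat :: "nat list set \<Rightarrow> nat list set \<Rightarrow> (nat \<Rightarrow> nat) set" where
  "hyperconcat T\<^sub>Q T\<^sub>P = paths (hyperconcat_tree T\<^sub>Q T\<^sub>P)"

end

theory Submission
  imports Defs "HOL-Library.More_List"
begin

text \<open>
  Reduction: from \<open>f \<in> DNR (k\<^sup>2)\<close> one computes, for all \<open>d\<close> and \<open>e\<close>, a pair that differs from
  \<open>(\<Phi>\<^sub>d(d), \<Phi>\<^sub>e(e))\<close> in at least one component. For \<open>d = 0, 1, \<dots>\<close> one follows the second components
  as a function of \<open>e\<close> along \<open>T\<^sub>P\<close>. If they stay in \<open>T\<^sub>P\<close>, they form an element of \<open>DNR k\<close>. Otherwise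
  some second component is \<open>\<Phi>\<^sub>e(e)\<close>; such an \<open>e\<close> can be found, the first component of its pair is then
  a correct value \<open>\<tau>(d)\<close>, and after extending the string written in \<open>T\<^sub>P\<close> to a leaf one appends \<open>\<tau>(d)\<close>
  and continues with \<open>d + 1\<close>.

  Non-reducibility: as every string of \<open>T\<^sub>P\<close> extends to a leaf, it extends to an element of the
  hyperconcatenation. Given a functional \<open>\<Gamma>\<close> into \<open>DNR m\<close>, let \<open>h(x)\<close> be its value at \<open>x\<close> on the first
  string of \<open>T\<^sub>P\<close> on which it converges. Then \<open>h\<close> is computable, so \<open>h = \<Phi>\<^sub>i\<close> for some \<open>i\<close>, and
  \<open>\<Gamma>\<close> takes the forbidden value \<open>h(i) = \<Phi>\<^sub>i(i)\<close> at \<open>i\<close> on an element of the hyperconcatenation.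
\<close>

section \<open>Total computable functions\<close>

text \<open>One program serves all oracles, so \<open>F\<close> is a total functional; a function
  ignoring \<open>g\<close> is computable in the ordinary sense.\<close>

definition computable :: "((nat \<Rightarrow> nat) \<Rightarrow> nat \<Rightarrow> nat) \<Rightarrow> bool" where
  "computable F \<longleftrightarrow> (\<exists>c. \<forall>g x. runs g c x (F g x))"

definition decidable :: "((nat \<Rightarrow> nat) \<Rightarrow> nat \<Rightarrow> bool) \<Rightarrow> bool" where
  "decidable P \<longleftrightarrow> computable (\<lambda>g x. of_bool (P g x))"

named_theorems computable_intros

lemma computableI: "(\<And>g x. runs g c x (F g x)) \<Longrightarrow> computable F"
  unfolding computable_def by blast

lemma computable_cong: "computable F \<Longrightarrow> (\<And>g x. G g x = F g x) \<Longrightarrow> computable G"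
  unfolding computable_def by simp

lemma computable_comp:
  assumes "computable H" "computable F"
  shows "computable (\<lambda>g x. H g (F g x))"
proof -
  obtain c d where "\<And>g x. runs g c x (H g x)" "\<And>g x. runs g d x (F g x)"
    using assms unfolding computable_def by metis
  then show ?thesis by (intro computableI[of "Comp c d"]) (rule runs.Comp)
qed

lemma computable_prod_encode [computable_intros]:
  assumes "computable F" "computable G"
  shows "computable (\<lambda>g x. prod_encode (F g x, G g x))"
proof -
  obtain c d where "\<And>g x. runs g c x (F g x)" "\<And>g x. runs g d x (G g x)"
    using assms unfolding computable_def by metis
  then show ?thesis by (intro computableI[of "Join c d"]) (rule runs.Join)
qed

lemma runs_Left_decode: "runs g Left x (fst (prod_decode x))"
  using runs.Left[of g "fst (prod_decode x)" "snd (prod_decode x)"] by simp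

lemma runs_Right_decode: "runs g Right x (snd (prod_decode x))"
  using runs.Right[of g "fst (prod_decode x)" "snd (prod_decode x)"] by simp

lemma computable_id [computable_intros]: "computable (\<lambda>g x. x)"
  \<comment> \<open>\<open>code\<close> has no identity program; the argument is rebuilt from its
    two projections.\<close>
  using computable_prod_encode[OF computableI[OF runs_Left_decode] computableI[OF runs_Right_decode]]
  by simp

lemma computable_Suc [computable_intros]:
  "computable F \<Longrightarrow> computable (\<lambda>g x. Suc (F g x))"
  by (rule computable_comp[where H = "\<lambda>g x. Suc x", OF computableI[OF runs.Succ]])

lemma computable_oracle [computable_intros]:
  "computable F \<Longrightarrow> computable (\<lambda>g x. g (F g x))"
  by (rule computable_comp[where H = "\<lambda>g x. g x", OF computableI[OF runs.Oracle]])

lemma computable_fst [computable_intros]: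
  "computable F \<Longrightarrow> computable (\<lambda>g x. fst (prod_decode (F g x)))"
  by (rule computable_comp[where H = "\<lambda>g x. fst (prod_decode x)", OF computableI[OF runs_Left_decode]])

lemma computable_snd [computable_intros]:
  "computable F \<Longrightarrow> computable (\<lambda>g x. snd (prod_decode (F g x)))"
  by (rule computable_comp[where H = "\<lambda>g x. snd (prod_decode x)", OF computableI[OF runs_Right_decode]])

lemma computable_const [computable_intros]: "computable (\<lambda>g x. n)"
proof (induction n)
  case 0
  then show ?case by (rule computableI[OF runs.Zero])
next
  case (Suc n)
  then show ?case by (rule computable_Suc)
qed

text \<open>The step function of a recursion, or the body of a search, receives the surrounding
  argument \<open>x\<close> as a parameter, so that closure under all operations below can be applied as
  introduction rules to functions written in direct style.\<close>

lemma computable_rec_nat [computable_intros]: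
  assumes "computable A" "computable N"
    and "computable (\<lambda>g z. B g (fst (prod_decode z)) (fst (prod_decode (snd (prod_decode z))))
      (snd (prod_decode (snd (prod_decode z)))))"
  shows "computable (\<lambda>g x. rec_nat (A g x) (B g x) (N g x))"
proof -
  obtain a where a: "\<And>g x. runs g a x (A g x)"
    using assms(1) unfolding computable_def by metis
  obtain b where b: "\<And>g z. runs g b z (B g (fst (prod_decode z))
      (fst (prod_decode (snd (prod_decode z)))) (snd (prod_decode (snd (prod_decode z)))))"
    using assms(3) unfolding computable_def by metis
  have "runs g (PrimRec a b) (prod_encode (x, n)) (rec_nat (A g x) (B g x) n)" for g x n
  proof (induction n)
    case 0
    then show ?case using a by (auto intro: runs.PrimRec_0)
  next
    case (Suc n)
    show ?case
      using runs.PrimRec_Suc[OF Suc b] by simp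
  qed
  then have "runs g (PrimRec a b) x
      (rec_nat (A g (fst (prod_decode x))) (B g (fst (prod_decode x))) (snd (prod_decode x)))" for g x
    by (metis prod.collapse prod_decode_inverse)
  then have "computable (\<lambda>g x. rec_nat (A g (fst (prod_decode x))) (B g (fst (prod_decode x)))
      (snd (prod_decode x)))"
    by (rule computableI)
  from computable_comp[OF this computable_prod_encode[OF computable_id assms(2)]]
  show ?thesis by simp
qed

lemma computable_of_bool [computable_intros]:
  "decidable P \<Longrightarrow> computable (\<lambda>g x. of_bool (P g x))"
  unfolding decidable_def .

lemma computable_if [computable_intros]:
  assumes "decidable P" "computable F" "computable G"
  shows "computable (\<lambda>g x. if P g x then F g x else G g x)"
proof (rule computable_cong)
  \<comment> \<open>A recursion of length 0 or 1 acts as the case distinction.\<close>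
  show "computable (\<lambda>g x. rec_nat (G g x) (\<lambda>_ _. F g x) (of_bool (P g x)))"
    by (intro assms computable_comp[OF assms(2)] computable_intros)
qed simp

lemma computable_add [computable_intros]:
  assumes "computable F" "computable G"
  shows "computable (\<lambda>g x. F g x + G g x)"
proof (rule computable_cong)
  show "computable (\<lambda>g x. rec_nat (F g x) (\<lambda>_ y. Suc y) (G g x))"
    by (intro computable_intros assms)
  show "F g x + G g x = rec_nat (F g x) (\<lambda>_ y. Suc y) (G g x)" for g x
  proof -
    have "rec_nat a (\<lambda>_ y. Suc y) n = a + n" for a n
      by (induction n) auto
    then show ?thesis by simp
  qed
qed

lemma computable_pred [computable_intros]:
  assumes "computable F"
  shows "computable (\<lambda>g x. F g x - 1)"
proof (rule computable_cong)
  show "computable (\<lambda>g x. rec_nat 0 (\<lambda>n _. n) (F g x))"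
    by (intro computable_intros assms)
  show "F g x - 1 = rec_nat 0 (\<lambda>n _. n) (F g x)" for g x
    by (cases "F g x") auto
qed

lemma computable_diff [computable_intros]:
  assumes "computable F" "computable G"
  shows "computable (\<lambda>g x. F g x - G g x)"
proof (rule computable_cong)
  show "computable (\<lambda>g x. rec_nat (F g x) (\<lambda>_ y. y - 1) (G g x))"
    by (intro computable_intros assms)
  have "rec_nat a (\<lambda>_ y. y - 1) n = a - n" for a n :: nat
    by (induction n) auto
  then show "F g x - G g x = rec_nat (F g x) (\<lambda>_ y. y - 1) (G g x)" for g x
    by simp
qed

lemma computable_mult [computable_intros]:
  assumes "computable F" "computable G"
  shows "computable (\<lambda>g x. F g x * G g x)"
proof (rule computable_cong)
  show "computable (\<lambda>g x. rec_nat 0 (\<lambda>_ y. y + F g x) (G g x))"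
    by (intro assms(2) computable_comp[OF assms(1)] computable_intros)
  have "rec_nat 0 (\<lambda>_ y. y + a) n = a * n" for a n :: nat
    by (induction n) auto
  then show "F g x * G g x = rec_nat 0 (\<lambda>_ y. y + F g x) (G g x)" for g x
    by simp
qed

section \<open>Decidable predicates, bounded quantification and total search\<close>

lemma decidableI:
  "computable F \<Longrightarrow> (\<And>g x. of_bool (P g x) = F g x) \<Longrightarrow> decidable P"
  unfolding decidable_def by simp

lemma decidable_le [computable_intros]:
  assumes "computable F" "computable G"
  shows "decidable (\<lambda>g x. F g x \<le> G g x)"
  by (rule decidableI[of "\<lambda>g x. 1 - (F g x - G g x)"]) (intro computable_intros assms, auto)

lemma decidable_less [computable_intros]:
  assumes "computable F" "computable G"
  shows "decidable (\<lambda>g x. F g x < G g x)"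
  by (rule decidableI[of "\<lambda>g x. 1 - (Suc (F g x) - G g x)"]) (intro computable_intros assms, auto)

lemma decidable_not [computable_intros]:
  assumes "decidable P"
  shows "decidable (\<lambda>g x. \<not> P g x)"
  by (rule decidableI[of "\<lambda>g x. 1 - of_bool (P g x)"]) (intro computable_intros assms, auto)

lemma decidable_conj [computable_intros]:
  assumes "decidable P" "decidable Q"
  shows "decidable (\<lambda>g x. P g x \<and> Q g x)"
  by (rule decidableI[of "\<lambda>g x. of_bool (P g x) * of_bool (Q g x)"])
    (intro computable_intros assms, auto)

lemma decidable_disj [computable_intros]:
  assumes "decidable P" "decidable Q"
  shows "decidable (\<lambda>g x. P g x \<or> Q g x)"
  using decidable_not[OF decidable_conj[OF assms[THEN decidable_not]]] by simp

lemma decidable_imp [computable_intros]: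
  assumes "decidable P" "decidable Q"
  shows "decidable (\<lambda>g x. P g x \<longrightarrow> Q g x)"
  using decidable_not[OF decidable_conj[OF assms(1) assms(2)[THEN decidable_not]]] by simp

lemma decidable_eq [computable_intros]:
  assumes "computable F" "computable G"
  shows "decidable (\<lambda>g x. F g x = G g x)"
  using decidable_conj[OF decidable_le[OF assms] decidable_le[OF assms(2,1)]]
  by (simp add: order_eq_iff)

lemma decidable_comp:
  assumes "decidable P" "computable F"
  shows "decidable (\<lambda>g x. P g (F g x))"
  using computable_comp[OF assms(1)[unfolded decidable_def] assms(2)]
  unfolding decidable_def .

abbreviation decidable_under :: "((nat \<Rightarrow> nat) \<Rightarrow> nat \<Rightarrow> nat \<Rightarrow> bool) \<Rightarrow> bool" where
  "decidable_under P \<equiv> decidable (\<lambda>g z. P g (fst (prod_decode z)) (snd (prod_decode z)))"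

lemma decidable_under_comp:
  assumes "decidable_under P" "computable F" "computable G"
  shows "decidable (\<lambda>g x. P g (F g x) (G g x))"
  using decidable_comp[OF assms(1) computable_prod_encode[OF assms(2,3)]] by simp

lemma decidable_Ball [computable_intros]:
  assumes "computable N" "decidable_under P"
  shows "decidable (\<lambda>g x. \<forall>i<N g x. P g x i)"
proof (rule decidableI)
  show "computable (\<lambda>g x. rec_nat 1 (\<lambda>i y. y * of_bool (P g x i)) (N g x))"
    by (intro assms(1) decidable_under_comp[OF assms(2)] computable_intros)
  have "rec_nat 1 (\<lambda>i y. y * of_bool (P g x i)) n = (of_bool (\<forall>i<n. P g x i) :: nat)" for g x n
    by (induction n) (auto simp: less_Suc_eq)
  then show "of_bool (\<forall>i<N g x. P g x i) = (rec_nat 1 (\<lambda>i y. y * of_bool (P g x i)) (N g x) :: nat)" for g x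
    by simp
qed

lemma computable_Least [computable_intros]:
  assumes "decidable_under P" and ex: "\<And>g x. \<exists>n. P g x n"
  shows "computable (\<lambda>g x. LEAST n. P g x n)"
proof -
  obtain c where "\<And>g z. runs g c z (of_bool (\<not> P g (fst (prod_decode z)) (snd (prod_decode z))))"
    using decidable_not[OF assms(1)] unfolding decidable_def computable_def by metis
  then have c: "runs g c (prod_encode (x, n)) (of_bool (\<not> P g x n))" for g x n
    by (metis fst_conv prod_encode_inverse snd_conv)
  \<comment> \<open>\<open>Mu\<close> stops at a zero, so \<open>c\<close> tests the negation of
    \<open>P\<close>. The induction descends from the minimum, where the search stops, to the
    starting point.\<close>
  have "runs g (Mu c) (prod_encode (x, n)) (LEAST n. P g x n)" if "n \<le> (LEAST n. P g x n)" for g x n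
    using that
  proof (induction n rule: inc_induct)
    case base
    show ?case using c[of g x "LEAST n. P g x n"] LeastI_ex[OF ex]
      by (auto intro: runs.Mu_found)
  next
    case (step n)
    then show ?case using c[of g x n] not_less_Least[of n "P g x"]
      by (auto intro: runs.Mu_next)
  qed
  then have "runs g (Mu c) (prod_encode (x, 0)) (LEAST n. P g x n)" for g x
    by simp
  moreover obtain d where "\<And>g x. runs g d x (prod_encode (x, 0))"
    using computable_prod_encode[OF computable_id computable_const[of 0]]
    unfolding computable_def by auto
  ultimately show ?thesis
    by (intro computableI[of "Comp (Mu c) d"]) (rule runs.Comp)
qed

section \<open>Computing with encoded lists\<close>

text \<open>A list-valued function \<open>L\<close> is treated through \<open>\<lambda>g x. list_encode (L g x)\<close>.\<close>

lemma computable_list_decode [computable_intros]: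
  "computable F \<Longrightarrow> computable (\<lambda>g x. list_encode (list_decode (F g x)))"
  by simp

lemma computable_Cons [computable_intros]:
  "computable F \<Longrightarrow> computable (\<lambda>g x. list_encode (L g x)) \<Longrightarrow>
    computable (\<lambda>g x. list_encode (F g x # L g x))"
  by (simp, intro computable_intros)

lemma list_encode_tl: "list_encode (tl xs) = snd (prod_decode (list_encode xs - 1))"
proof -
  \<comment> \<open>This covers the empty list, whose code is 0, so iterated tails need no case
    distinction.\<close>
  have "prod_decode 0 = (0, 0)"
    using prod_encode_inverse[of "(0, 0)"] by (simp add: prod_encode_def)
  then show ?thesis by (cases xs) auto
qed

lemma hd_conv_list_encode: "xs \<noteq> [] \<Longrightarrow> hd xs = fst (prod_decode (list_encode xs - 1))"
  by (cases xs) auto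

lemma list_encode_eq_0_iff: "list_encode xs = 0 \<longleftrightarrow> xs = []"
  by (cases xs) auto

lemma computable_drop [computable_intros]:
  assumes "computable N" "computable (\<lambda>g x. list_encode (L g x))"
  shows "computable (\<lambda>g x. list_encode (drop (N g x) (L g x)))"
proof (rule computable_cong)
  show "computable (\<lambda>g x. rec_nat (list_encode (L g x)) (\<lambda>_ y. snd (prod_decode (y - 1))) (N g x))"
    by (intro assms computable_intros)
  have "list_encode (drop n xs) = rec_nat (list_encode xs) (\<lambda>_ y. snd (prod_decode (y - 1))) n" for n xs
  proof (induction n)
    case (Suc n)
    have "drop (Suc n) xs = tl (drop n xs)" by (simp add: drop_Suc tl_drop)
    then show ?case by (simp add: Suc list_encode_tl)
  qed simp
  then show "list_encode (drop (N g x) (L g x)) =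
      rec_nat (list_encode (L g x)) (\<lambda>_ y. snd (prod_decode (y - 1))) (N g x)" for g x .
qed

lemma computable_length [computable_intros]:
  assumes "computable (\<lambda>g x. list_encode (L g x))"
  shows "computable (\<lambda>g x. length (L g x))"
proof (rule computable_cong)
  have "computable (\<lambda>g z. list_encode (L g (fst (prod_decode z))))"
    by (intro computable_comp[OF assms] computable_intros)
  then show "computable (\<lambda>g x. LEAST n. list_encode (drop n (L g x)) = 0)"
    by (intro computable_intros) (auto simp: list_encode_eq_0_iff)
  show "length (L g x) = (LEAST n. list_encode (drop n (L g x)) = 0)" for g x
    by (rule Least_equality[symmetric]) (auto simp: list_encode_eq_0_iff)
qed

lemma computable_nth_default [computable_intros]:
  assumes "computable (\<lambda>g x. list_encode (L g x))" "computable N"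
  shows "computable (\<lambda>g x. nth_default 0 (L g x) (N g x))"
proof (rule computable_cong)
  show "computable (\<lambda>g x. if N g x < length (L g x)
      then fst (prod_decode (list_encode (drop (N g x) (L g x)) - 1)) else 0)"
    by (intro assms computable_intros)
  show "nth_default 0 (L g x) (N g x) = (if N g x < length (L g x)
      then fst (prod_decode (list_encode (drop (N g x) (L g x)) - 1)) else 0)" for g x
    by (simp add: nth_default_def hd_conv_list_encode flip: hd_drop_conv_nth)
qed

lemma computable_append [computable_intros]:
  assumes "computable (\<lambda>g x. list_encode (K g x))" "computable (\<lambda>g x. list_encode (L g x))"
  shows "computable (\<lambda>g x. list_encode (K g x @ L g x))"
proof (rule computable_cong)
  \<comment> \<open>The entries of \<open>xs\<close> are put in front of \<open>ys\<close> one by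
    one, starting with the last.\<close>
  let ?r = "\<lambda>xs ys. rec_nat (list_encode ys)
    (\<lambda>j r. list_encode (nth_default 0 xs (length xs - Suc j) # list_decode r))"
  have "computable (\<lambda>g z. list_encode (K g (fst (prod_decode z))))"
    by (intro computable_comp[OF assms(1)] computable_intros)
  then show "computable (\<lambda>g x. ?r (K g x) (L g x) (length (K g x)))"
    by (intro assms computable_intros)
  have "?r xs ys j = list_encode (drop (length xs - j) xs @ ys)" if "j \<le> length xs" for j xs ys
    using that
  proof (induction j)
    case (Suc j)
    then have "drop (length xs - Suc j) xs = xs ! (length xs - Suc j) # drop (length xs - j) xs"
      using Cons_nth_drop_Suc[of "length xs - Suc j" xs] by (simp add: Suc_diff_Suc)
    moreover have "length xs - Suc j < length xs"
      using Suc.prems by linarith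
    ultimately show ?case using Suc by (simp add: nth_default_def)
  qed simp
  then show "list_encode (K g x @ L g x) = ?r (K g x) (L g x) (length (K g x))" for g x
    by simp
qed

lemma computable_map_upt [computable_intros]:
  assumes "computable (\<lambda>g z. F g (fst (prod_decode z)) (snd (prod_decode z)))" "computable N"
  shows "computable (\<lambda>g x. list_encode (map (F g x) [0..<N g x]))"
proof (rule computable_cong)
  have F: "computable (\<lambda>g x. F g (A g x) (B g x))" if "computable A" "computable B" for A B
    using computable_comp[OF assms(1) computable_prod_encode[OF that]] by simp
  show "computable (\<lambda>g x. rec_nat (list_encode []) (\<lambda>n r. list_encode (list_decode r @ [F g x n])) (N g x))"
    by (intro assms(2) F computable_intros)
  have "list_encode (map (F g x) [0..<n]) =
      rec_nat (list_encode []) (\<lambda>n r. list_encode (list_decode r @ [F g x n])) n" for g x n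
  proof (induction n)
    case (Suc n)
    then show ?case by (simp del: list_encode.simps flip: Suc)
  qed simp
  then show "list_encode (map (F g x) [0..<N g x]) =
      rec_nat (list_encode []) (\<lambda>n r. list_encode (list_decode r @ [F g x n])) (N g x)" for g x .
qed

lemma computable_mod [computable_intros]:
  assumes "computable F" "0 < k"
  shows "computable (\<lambda>g x. F g x mod k)"
proof (rule computable_cong)
  show "computable (\<lambda>g x. rec_nat 0 (\<lambda>_ y. if Suc y = k then 0 else Suc y) (F g x))"
    by (intro assms computable_intros)
  have "n mod k = rec_nat 0 (\<lambda>_ y. if Suc y = k then 0 else Suc y) n" for n
    using assms(2) by (induction n) (auto simp: mod_Suc)
  then show "F g x mod k = rec_nat 0 (\<lambda>_ y. if Suc y = k then 0 else Suc y) (F g x)" for g x .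
qed

lemma computable_div [computable_intros]:
  assumes "computable F" "0 < k"
  shows "computable (\<lambda>g x. F g x div k)"
proof (rule computable_cong)
  show "computable (\<lambda>g x. rec_nat 0 (\<lambda>n y. if Suc n mod k = 0 then Suc y else y) (F g x))"
    by (intro assms computable_intros)
  have "n div k = rec_nat 0 (\<lambda>n y. if Suc n mod k = 0 then Suc y else y) n" for n
    by (induction n) (auto simp: div_Suc)
  then show "F g x div k = rec_nat 0 (\<lambda>n y. if Suc n mod k = 0 then Suc y else y) (F g x)" for g x .
qed

section \<open>Indices\<close>

lemma code_of_Join: "code_of (5 + 4 * prod_encode (i, j)) = Join (code_of i) (code_of j)"
  by (subst code_of.simps) simp

lemma code_of_Comp: "code_of (6 + 4 * prod_encode (i, j)) = Comp (code_of i) (code_of j)"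
proof -
  have "Suc (4 * m) div 4 = m" "Suc (4 * m) mod 4 = 1" for m :: nat
    by presburger+
  then show ?thesis by (subst code_of.simps) simp
qed

lemma Phi_eq_Some_iff: "Phi e x = Some y \<longleftrightarrow> runs (\<lambda>_. 0) (code_of e) x y"
  unfolding Phi_def by (rule Phi_oracle_eq_Some_iff)

lemma computable_code_of: "computable F \<Longrightarrow> \<exists>i. \<forall>g x. runs g (code_of i) x (F g x)"
  using surj_code_of unfolding computable_def surj_def by metis

lemma computable_imp_Phi: "computable (\<lambda>g. F) \<Longrightarrow> \<exists>e. \<forall>x. Phi e x = Some (F x)"
  using computable_code_of unfolding Phi_eq_Some_iff by blast

text \<open>An index of the constant function with value \<open>n\<close>: 0 and 1 are the indices
  of \<open>Zero\<close> and \<open>Succ\<close>, and \<open>6 + 4 * prod_encode (i, j)\<close> is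
  an index of a composition.\<close>

primrec const_index :: "nat \<Rightarrow> nat" where
  "const_index 0 = 0"
| "const_index (Suc n) = 6 + 4 * prod_encode (1, const_index n)"

lemma runs_const_index: "runs g (code_of (const_index n)) x n"
proof (induction n)
  case 0
  then show ?case by (simp add: code_of.simps runs.Zero)
next
  case (Suc n)
  have "code_of 1 = Succ" by (simp add: code_of.simps)
  then show ?case
    using runs.Comp[OF Suc runs.Succ] by (simp only: const_index.simps code_of_Comp)
qed

lemma computable_const_index [computable_intros]:
  assumes "computable F"
  shows "computable (\<lambda>g x. const_index (F g x))"
proof (rule computable_cong)
  show "computable (\<lambda>g x. rec_nat 0 (\<lambda>_ y. 6 + 4 * prod_encode (1, y)) (F g x))"
    by (intro assms computable_intros)
  have "const_index n = rec_nat 0 (\<lambda>_ y. 6 + 4 * prod_encode (1, y)) n" for n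
    by (induction n) auto
  then show "const_index (F g x) = rec_nat 0 (\<lambda>_ y. 6 + 4 * prod_encode (1, y)) (F g x)" for g x .
qed

text \<open>If \<open>c\<close> is an index of a binary operation, then \<open>diag_index c d e\<close> is an index of the constant
  function whose value is that operation applied to \<open>\<Phi>\<^sub>d(d)\<close> and \<open>\<Phi>\<^sub>e(e)\<close>.\<close>

definition diag_index :: "nat \<Rightarrow> nat \<Rightarrow> nat \<Rightarrow> nat" where
  "diag_index c d e = 6 + 4 * prod_encode (c, 5 + 4 * prod_encode
    (6 + 4 * prod_encode (d, const_index d), 6 + 4 * prod_encode (e, const_index e)))"

lemma computable_diag_index [computable_intros]:
  "computable D \<Longrightarrow> computable E \<Longrightarrow> computable (\<lambda>g x. diag_index c (D g x) (E g x))"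
  unfolding diag_index_def by (intro computable_intros)

text \<open>The coded function ignores \<open>x\<close>, which can therefore be taken to be the
  index itself, giving a diagonal value.\<close>

lemma Phi_diag_index:
  assumes "Phi d d = Some a" "Phi e e = Some b" "Phi c (prod_encode (a, b)) = Some v"
  shows "Phi (diag_index c d e) x = Some v"
  using assms runs_const_index[of "\<lambda>_. 0"] unfolding Phi_eq_Some_iff diag_index_def code_of_Comp code_of_Join
  by (blast intro: runs.Comp runs.Join)

section \<open>Trees\<close>

text \<open>\<open>Phi\<close> runs with the zero oracle. Answering every query by
  \<open>Zero\<close> transfers its computations to any oracle, so trees can be decided while the
  oracle is \<open>f\<close>.\<close>

primrec without_oracle :: "code \<Rightarrow> code" where
  "without_oracle Zero = Zero"
| "without_oracle Succ = Succ"
| "without_oracle Left = Left"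
| "without_oracle Right = Right"
| "without_oracle Oracle = Zero"
| "without_oracle (Join c d) = Join (without_oracle c) (without_oracle d)"
| "without_oracle (Comp c d) = Comp (without_oracle c) (without_oracle d)"
| "without_oracle (PrimRec c d) = PrimRec (without_oracle c) (without_oracle d)"
| "without_oracle (Mu c) = Mu (without_oracle c)"

lemma runs_without_oracle: "runs (\<lambda>_. 0) c x y \<Longrightarrow> runs g (without_oracle c) x y"
  by (induction rule: runs.induct) (simp_all, (rule runs.intros; assumption)+)

lemma computable_strings_imp_decidable:
  assumes "computable_strings T" "computable (\<lambda>g x. list_encode (L g x))"
  shows "decidable (\<lambda>g x. L g x \<in> T)"
proof -
  obtain e where "\<And>\<sigma>. runs (\<lambda>_. 0) (code_of e) (list_encode \<sigma>) (if \<sigma> \<in> T then 1 else 0)"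
    using assms(1) unfolding computable_strings_def Phi_eq_Some_iff by blast
  then have "runs g (without_oracle (code_of e)) x (of_bool (list_decode x \<in> T))" for g x
    using runs_without_oracle[of "code_of e" x] by (metis list_decode_inverse of_bool_def)
  then have "decidable (\<lambda>g x. list_decode x \<in> T)"
    unfolding decidable_def by (rule computableI)
  from decidable_comp[OF this assms(2)] show ?thesis by simp
qed

section \<open>Bounded quantification over strings\<close>

lemma prod_encode_mono: "a \<le> a' \<Longrightarrow> b \<le> b' \<Longrightarrow> prod_encode (a, b) \<le> prod_encode (a', b')"
proof -
  assume *: "a \<le> a'" "b \<le> b'"
  have "mono triangle" by (rule mono_iff_le_Suc[THEN iffD2]) simp
  then have "triangle (a + b) \<le> triangle (a' + b')"
    by (rule monoD) (use * in simp)
  with * show ?thesis by (simp add: prod_encode_def)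
qed

lemma list_encode_le_replicate:
  "\<sigma> \<in> lists {..<k} \<Longrightarrow> list_encode \<sigma> \<le> list_encode (replicate (length \<sigma>) k)"
  by (induction \<sigma>) (auto intro!: prod_encode_mono)

text \<open>By monotonicity of the coding, the code of the constant string with entry
  \<open>k\<close> bounds the codes of all strings concerned, so the quantifier becomes a bounded
  one over numbers.\<close>

lemma decidable_ball_strings [computable_intros]:
  assumes "computable N" "decidable_under (\<lambda>g x w. P g x (list_decode w))"
  shows "decidable (\<lambda>g x. \<forall>\<sigma>\<in>lists {..<k}. length \<sigma> = N g x \<longrightarrow> P g x \<sigma>)"
proof -
  let ?D = "\<lambda>g x. \<forall>w<Suc (list_encode (map (\<lambda>_. k) [0..<N g x])).
    (\<forall>i<length (list_decode w). nth_default 0 (list_decode w) i < k) \<and> length (list_decode w) = N g x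
      \<longrightarrow> P g x (list_decode w)"
  have "decidable ?D"
    by (intro computable_intros computable_comp[OF assms(1)] assms)
  moreover have "?D g x \<longleftrightarrow> (\<forall>\<sigma>\<in>lists {..<k}. length \<sigma> = N g x \<longrightarrow> P g x \<sigma>)" for g x
  proof
    assume D: "?D g x"
    show "\<forall>\<sigma>\<in>lists {..<k}. length \<sigma> = N g x \<longrightarrow> P g x \<sigma>"
    proof (intro ballI impI)
      fix \<sigma> assume \<sigma>: "\<sigma> \<in> lists {..<k}" "length \<sigma> = N g x"
      then have "list_encode \<sigma> < Suc (list_encode (map (\<lambda>_. k) [0..<N g x]))"
        using list_encode_le_replicate[OF \<sigma>(1)] by (simp add: map_replicate_const less_Suc_eq_le)
      moreover have "\<forall>i<length \<sigma>. nth_default 0 \<sigma> i < k"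
        using \<sigma>(1) by (auto simp: nth_default_def in_lists_conv_set)
      ultimately show "P g x \<sigma>" using D \<sigma>(2) by (metis list_encode_inverse)
    qed
  next
    assume "\<forall>\<sigma>\<in>lists {..<k}. length \<sigma> = N g x \<longrightarrow> P g x \<sigma>"
    moreover have "list_decode w \<in> lists {..<k}"
      if "\<forall>i<length (list_decode w). nth_default 0 (list_decode w) i < k" for w
      using that by (auto simp: in_set_conv_nth nth_default_def)
    ultimately show "?D g x" by blast
  qed
  ultimately show ?thesis by simp
qed

text \<open>The union of a chain of strings whose \<open>n\<close>-th member has length at least
  \<open>n\<close>; stage \<open>Suc n\<close> is the first sure to have an entry at position
  \<open>n\<close>.\<close>

definition limit :: "(nat \<Rightarrow> 'a list) \<Rightarrow> nat \<Rightarrow> 'a" where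
  "limit \<sigma> n = \<sigma> (Suc n) ! n"

lemma map_limit:
  assumes "\<And>n. prefix (\<sigma> n) (\<sigma> (Suc n))" "\<And>n. n \<le> length (\<sigma> n)"
  shows "map (limit \<sigma>) [0..<n] = take n (\<sigma> n)"
proof (induction n)
  case (Suc n)
  have "take n (\<sigma> (Suc n)) = take n (\<sigma> n)"
    using assms(1)[of n] assms(2)[of n] by (auto elim!: prefixE)
  moreover have "n < length (\<sigma> (Suc n))"
    using assms(2)[of "Suc n"] by simp
  ultimately show ?case using Suc by (simp add: limit_def take_Suc_conv_app_nth)
qed simp

lemma prefix_limit:
  assumes "\<And>n. prefix (\<sigma> n) (\<sigma> (Suc n))" "\<And>n. n \<le> length (\<sigma> n)"
  shows "prefix (map (limit \<sigma>) [0..<n]) (\<sigma> n)"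
  unfolding map_limit[OF assms] by (rule take_is_prefix)

lemma limit_in_paths:
  assumes "is_tree T" "\<And>n. \<sigma> n \<in> T" "\<And>n. prefix (\<sigma> n) (\<sigma> (Suc n))" "\<And>n. n \<le> length (\<sigma> n)"
  shows "limit \<sigma> \<in> paths T"
  using assms(1,2) prefix_limit[OF assms(3,4)] unfolding paths_def is_tree_def by blast

lemma map_limit_length:
  assumes "\<And>n. prefix (\<sigma> n) (\<sigma> (Suc n))" "\<And>n. n \<le> length (\<sigma> n)"
  shows "map (limit \<sigma>) [0..<length (\<sigma> n)] = \<sigma> n"
proof -
  have "prefix (\<sigma> n) (\<sigma> m)" if "n \<le> m" for m
    using that by (induction m rule: dec_induct) (auto intro: prefix_order.trans assms(1))
  then have "prefix (\<sigma> n) (\<sigma> (length (\<sigma> n)))"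
    using assms(2) by blast
  then show ?thesis unfolding map_limit[OF assms] by (auto elim!: prefixE)
qed

lemma koenig:
  assumes "is_tree T" "T \<subseteq> lists {..<k :: nat}" "\<And>n. \<exists>\<sigma>\<in>T. n \<le> length \<sigma>"
  shows "paths T \<noteq> {}"
proof -
  define ext where "ext \<sigma> \<longleftrightarrow> (\<forall>n. \<exists>\<tau>\<in>T. prefix \<sigma> \<tau> \<and> n \<le> length \<tau>)" for \<sigma>
  have step: "\<exists>i. ext (\<sigma> @ [i])" if "ext \<sigma>" for \<sigma>
  proof (rule ccontr)
    assume "\<nexists>i. ext (\<sigma> @ [i])"
    then obtain N where N: "\<And>i \<tau>. \<tau> \<in> T \<Longrightarrow> prefix (\<sigma> @ [i]) \<tau> \<Longrightarrow> length \<tau> < N i"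
      unfolding ext_def by (metis not_le)
    \<comment> \<open>A string above \<open>\<sigma>\<close> longer than the sum of the bounds
      passes through some child \<open>i < k\<close> and exceeds its bound
      \<open>N i\<close>.\<close>
    obtain \<tau> where \<tau>: "\<tau> \<in> T" "prefix \<sigma> \<tau>" "Suc (length \<sigma>) + (\<Sum>i<k. N i) \<le> length \<tau>"
      using \<open>ext \<sigma>\<close> unfolding ext_def by blast
    then obtain i \<rho> where i: "\<tau> = \<sigma> @ i # \<rho>"
      by (cases "drop (length \<sigma>) \<tau>") (auto elim!: prefixE)
    then have "i < k" using \<tau>(1) assms(2) by auto
    then have "N i \<le> (\<Sum>i<k. N i)" by (intro member_le_sum) auto
    moreover have "length \<tau> < N i" using N[OF \<tau>(1), of i] i by simp
    ultimately show False using \<tau>(3) by simp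
  qed
  define \<sigma> where "\<sigma> = rec_nat [] (\<lambda>_ \<sigma>. \<sigma> @ [SOME i. ext (\<sigma> @ [i])])"
  have ext: "ext (\<sigma> n)" for n
  proof (induction n)
    case 0
    then show ?case using assms(3) by (auto simp: \<sigma>_def ext_def)
  next
    case (Suc n)
    then show ?case using someI_ex[OF step[OF Suc]] by (simp add: \<sigma>_def)
  qed
  have "\<sigma> n \<in> T" for n
    using ext[of n] assms(1) unfolding ext_def is_tree_def by blast
  moreover have "n \<le> length (\<sigma> n)" for n
    by (induction n) (auto simp: \<sigma>_def)
  moreover have "prefix (\<sigma> n) (\<sigma> (Suc n))" for n
    by (simp add: \<sigma>_def)
  ultimately show ?thesis using limit_in_paths[OF assms(1)] by blast
qed

section \<open>Bounded evaluation\<close>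

text \<open>Evaluation with a finite initial segment \<open>w\<close> of the oracle, whose length also bounds the
  searches; \<open>0\<close> stands for divergence and \<open>Suc y\<close> for the value \<open>y\<close>.\<close>

primrec ev :: "code \<Rightarrow> nat list \<Rightarrow> nat \<Rightarrow> nat" where
  "ev Zero w x = 1"
| "ev Succ w x = Suc (Suc x)"
| "ev Left w x = Suc (fst (prod_decode x))"
| "ev Right w x = Suc (snd (prod_decode x))"
| "ev Oracle w x = (if x < length w then Suc (nth_default 0 w x) else 0)"
| "ev (Join c d) w x = (if ev c w x = 0 \<or> ev d w x = 0 then 0
    else Suc (prod_encode (ev c w x - 1, ev d w x - 1)))"
| "ev (Comp c d) w x = (if ev d w x = 0 then 0 else ev c w (ev d w x - 1))"
| "ev (PrimRec c d) w x = rec_nat (ev c w (fst (prod_decode x)))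
    (\<lambda>n r. if r = 0 then 0 else ev d w (prod_encode (fst (prod_decode x), prod_encode (n, r - 1))))
    (snd (prod_decode x))"
| "ev (Mu c) w x =
    (let L = LEAST n. snd (prod_decode x) + length w \<le> n \<or>
        snd (prod_decode x) \<le> n \<and> ev c w (prod_encode (fst (prod_decode x), n)) < 2
     in if ev c w (prod_encode (fst (prod_decode x), L)) = 1 then Suc L else 0)"

lemma computable_ev [computable_intros]:
  assumes "computable (\<lambda>g x. list_encode (L g x))" "computable F"
  shows "computable (\<lambda>g x. ev c (L g x) (F g x))"
proof -
  let ?l = "\<lambda>z. list_decode (fst (prod_decode z))" and ?x = "\<lambda>z. snd (prod_decode z)"
  have lift: "computable (\<lambda>g x. ev c (M g x) (G g x))"
    if "computable (\<lambda>g z. ev c (?l z) (?x z))"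
      and "computable (\<lambda>g x. list_encode (M g x))" "computable G" for c M G
    using computable_comp[OF that(1) computable_prod_encode[OF that(2,3)]] by simp
  have "computable (\<lambda>g z. ev c (?l z) (?x z))"
  proof (induction c)
    case Zero
    then show ?case by (simp, intro computable_intros)
  next
    case Succ
    then show ?case by (simp, intro computable_intros)
  next
    case Left
    then show ?case by (simp, intro computable_intros)
  next
    case Right
    then show ?case by (simp, intro computable_intros)
  next
    case Oracle
    then show ?case by (simp only: ev.simps, intro computable_intros)
  next
    case (Join c d)
    show ?case
      by (simp only: ev.simps, intro lift[OF Join(1)] lift[OF Join(2)] computable_intros)
  next
    case (Comp c d)
    show ?case
      by (simp only: ev.simps, intro lift[OF Comp(1)] lift[OF Comp(2)] computable_intros)
  next
    case (PrimRec c d)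
    show ?case
      by (simp only: ev.simps, intro lift[OF PrimRec(1)] lift[OF PrimRec(2)] computable_intros)
  next
    case (Mu c)
    show ?case
      \<comment> \<open>The search bound always satisfies the first disjunct, so the least number
        exists.\<close>
      unfolding ev.simps Let_def
      by (intro lift[OF Mu] computable_intros) (rule exI, rule disjI1, rule order.refl)+
  qed
  then show ?thesis using assms by (rule lift)
qed

lemma ev_PrimRec_Suc:
  "ev (PrimRec c d) w (prod_encode (x, Suc n)) =
    (let r = ev (PrimRec c d) w (prod_encode (x, n))
     in if r = 0 then 0 else ev d w (prod_encode (x, prod_encode (n, r - 1))))"
  by (simp add: Let_def cong: if_cong)

text \<open>Values are shifted by one: 1 is the zero that ends a search successfully, at least 2
  means defined and nonzero, and 0 is divergence, which stops the search with failure.\<close>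

lemma ev_Mu_eq_Suc_iff:
  "ev (Mu c) w (prod_encode (x, m)) = Suc z \<longleftrightarrow> m \<le> z \<and> z \<le> m + length w \<and>
    ev c w (prod_encode (x, z)) = 1 \<and> (\<forall>n. m \<le> n \<and> n < z \<longrightarrow> 2 \<le> ev c w (prod_encode (x, n)))"
  (is "_ \<longleftrightarrow> ?R")
proof -
  let ?P = "\<lambda>n. m + length w \<le> n \<or> m \<le> n \<and> ev c w (prod_encode (x, n)) < 2"
  define L where "L = (LEAST n. ?P n)"
  have eq: "ev (Mu c) w (prod_encode (x, m)) = (if ev c w (prod_encode (x, L)) = 1 then Suc L else 0)"
    by (simp add: L_def)
  have L: "?P L" unfolding L_def by (rule LeastI[of _ "m + length w"]) simp
  have le: "L \<le> m + length w" unfolding L_def by (rule Least_le) simp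
  have less: "\<not> ?P n" if "n < L" for n
    using that not_less_Least unfolding L_def by blast
  show ?thesis
  proof
    assume "ev (Mu c) w (prod_encode (x, m)) = Suc z"
    then have "L = z" "ev c w (prod_encode (x, z)) = 1"
      unfolding eq by (auto split: if_splits)
    with L le less show ?R by (metis add_leD1 not_le)
  next
    assume R: ?R
    then have "L \<le> z" unfolding L_def by (intro Least_le) simp
    moreover have "\<not> L < z" using R L by (metis add_leD1 leD le_trans not_less)
    ultimately show "ev (Mu c) w (prod_encode (x, m)) = Suc z"
      using R unfolding eq by simp
  qed
qed

text \<open>A successful evaluation reads the oracle only within \<open>w\<close>, hence is a
  computation relative to any oracle extending \<open>w\<close>.\<close>

lemma ev_sound:
  assumes "\<And>i. i < length w \<Longrightarrow> w ! i = g i"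
  shows "ev c w x = Suc y \<Longrightarrow> runs g c x y"
proof (induction c arbitrary: x y)
  case Zero
  then show ?case by (auto intro: runs.Zero)
next
  case Succ
  then show ?case by (auto intro: runs.Succ)
next
  case Left
  then show ?case by (auto intro: runs_Left_decode)
next
  case Right
  then show ?case by (auto intro: runs_Right_decode)
next
  case Oracle
  then show ?case using assms runs.Oracle[of g x] by (auto simp: nth_default_def split: if_splits)
next
  case (Join c d)
  then show ?case by (auto split: if_splits intro!: runs.Join)
next
  case (Comp c d)
  then obtain z where z: "ev d w x = Suc z"
    by (cases "ev d w x") auto
  with Comp.prems have "ev c w z = Suc y" by simp
  with z show ?case by (intro runs.Comp Comp.IH)
next
  case (PrimRec c d)
  obtain a n where x: "x = prod_encode (a, n)"
    by (metis prod.collapse prod_decode_inverse)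
  have "runs g (PrimRec c d) (prod_encode (a, n)) y" if "ev (PrimRec c d) w (prod_encode (a, n)) = Suc y" for n y
    using that
  proof (induction n arbitrary: y)
    case 0
    then show ?case using PrimRec.IH(1) by (auto intro: runs.PrimRec_0)
  next
    case (Suc n)
    obtain r where r: "ev (PrimRec c d) w (prod_encode (a, n)) = Suc r"
      using Suc.prems unfolding ev_PrimRec_Suc
      by (cases "ev (PrimRec c d) w (prod_encode (a, n))") (auto simp: Let_def simp del: ev.simps)
    then have "ev d w (prod_encode (a, prod_encode (n, r))) = Suc y"
      using Suc.prems unfolding ev_PrimRec_Suc by (simp add: Let_def del: ev.simps)
    then show ?case by (intro runs.PrimRec_Suc[OF Suc.IH[OF r]] PrimRec.IH(2))
  qed
  then show ?case using PrimRec.prems unfolding x by blast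
next
  case (Mu c)
  obtain a m where x: "x = prod_encode (a, m)"
    by (metis prod.collapse prod_decode_inverse)
  note y = Mu.prems[unfolded x ev_Mu_eq_Suc_iff]
  have below: "2 \<le> ev c w (prod_encode (a, n))" if "m \<le> n" "n < y" for n
    using y that by simp
  have "n \<le> y \<Longrightarrow> m \<le> n \<Longrightarrow> runs g (Mu c) (prod_encode (a, n)) y" for n
  proof (induction n rule: inc_induct)
    case base
    show ?case using y Mu.IH by (intro runs.Mu_found) simp
  next
    case (step n)
    have "2 \<le> ev c w (prod_encode (a, n))"
      by (rule below) (use step in simp_all)
    then obtain v where v: "ev c w (prod_encode (a, n)) = Suc (Suc v)"
      by (metis add_2_eq_Suc le_Suc_ex)
    have "runs g (Mu c) (prod_encode (a, Suc n)) y"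
      using step by simp
    with Mu.IH[OF v] show ?case by (rule runs.Mu_next)
  qed
  then show ?case unfolding x using y by blast
qed

text \<open>A halting computation uses finitely many oracle values and finite searches; stating this
  eventually lets the thresholds of subcomputations be combined.\<close>

lemma ev_complete:
  "runs g c x y \<Longrightarrow> \<forall>\<^sub>F n in sequentially. ev c (map g [0..<n]) x = Suc y"
proof (induction rule: runs.induct)
  case (Oracle x)
  show ?case
    using eventually_gt_at_top[of x] by eventually_elim (simp add: nth_default_def)
next
  case Join
  show ?case using Join.IH by eventually_elim simp
next
  case Comp
  show ?case using Comp.IH by eventually_elim simp
next
  case PrimRec_0
  show ?case using PrimRec_0.IH by eventually_elim simp
next
  case PrimRec_Suc
  show ?case using PrimRec_Suc.IH
    by eventually_elim (simp add: ev_PrimRec_Suc Let_def del: ev.simps)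
next
  case Mu_found
  show ?case using Mu_found.IH
    by eventually_elim (simp add: ev_Mu_eq_Suc_iff del: ev.simps)
next
  case (Mu_next c x m y z)
  show ?case
    using Mu_next.IH eventually_ge_at_top[of z]
  proof (eventually_elim)
    case (elim n)
    then show ?case
      unfolding ev_Mu_eq_Suc_iff by (auto simp: le_less[of m] Suc_le_eq)
  qed
qed simp_all

section \<open>Trees of diagonally noncomputable functions\<close>

lemma DNR_not_computable: "computable (\<lambda>g. f) \<Longrightarrow> f \<notin> DNR k"
  using computable_imp_Phi[of f] unfolding DNR_def by blast

lemma DNR_nonempty: "2 \<le> k \<Longrightarrow> DNR k \<noteq> {}"
proof -
  assume "2 \<le> k"
  then have "(\<lambda>i. if Phi i i = Some 0 then 1 else 0) \<in> DNR k"
    by (auto simp: DNR_def)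
  then show ?thesis by blast
qed

lemma DNR_extension:
  assumes "2 \<le> k" "\<sigma> \<in> lists {..<k}" "\<And>i. i < length \<sigma> \<Longrightarrow> Phi i i \<noteq> Some (\<sigma> ! i)"
  shows "\<exists>f\<in>DNR k. map f [0..<length \<sigma>] = \<sigma>"
proof -
  obtain f where f: "f \<in> DNR k" using DNR_nonempty[OF assms(1)] by blast
  define h where "h i = (if i < length \<sigma> then \<sigma> ! i else f i)" for i
  have "h i < k" for i
    using f assms(2) nth_mem[of i \<sigma>] by (auto simp: h_def DNR_def)
  moreover have "Phi i i \<noteq> Some (h i)" for i
    using f assms(3)[of i] by (simp add: h_def DNR_def)
  ultimately have "h \<in> DNR k"
    unfolding DNR_def by blast
  moreover have "map h [0..<length \<sigma>] = \<sigma>"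
    by (rule nth_equalityI) (simp_all add: h_def)
  ultimately show ?thesis by blast
qed

lemma DNR_update: "f \<in> DNR k \<Longrightarrow> v < k \<Longrightarrow> Phi e e \<noteq> Some v \<Longrightarrow> f(e := v) \<in> DNR k"
  by (auto simp: DNR_def)

locale DNR_tree =
  fixes k :: nat and T :: "nat list set"
  assumes two_le_k: "2 \<le> k" and tree: "corresponding_tree k (DNR k) T"
begin

lemma is_tree_T: "is_tree T" and T_subset: "T \<subseteq> lists {..<k}"
  and computable_T: "computable_strings T" and paths_T: "paths T = DNR k"
  using tree unfolding corresponding_tree_def by auto

lemma T_prefix: "\<sigma> \<in> T \<Longrightarrow> prefix \<tau> \<sigma> \<Longrightarrow> \<tau> \<in> T"
  using is_tree_T unfolding is_tree_def by blast

lemma decidable_T [computable_intros]: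
  "computable (\<lambda>g x. list_encode (L g x)) \<Longrightarrow> decidable (\<lambda>g x. L g x \<in> T)"
  by (rule computable_strings_imp_decidable[OF computable_T])

lemma snoc_in_T_less: "\<sigma> @ [i] \<in> T \<Longrightarrow> i < k"
  using T_subset by auto

lemma leaves_T: "leaves T = {\<sigma>\<in>T. \<forall>i<k. \<sigma> @ [i] \<notin> T}"
  unfolding leaves_def using snoc_in_T_less by blast

lemma decidable_leaves [computable_intros]:
  assumes "computable (\<lambda>g x. list_encode (L g x))"
  shows "decidable (\<lambda>g x. L g x \<in> leaves T)"
  unfolding leaves_T mem_Collect_eq
  by (intro assms computable_comp[OF assms] computable_intros)

text \<open>Such a string extends to an element of \<open>DNR k\<close>, and a tree contains all
  initial segments of its paths. Hence this holds for every choice of the tree.\<close>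

lemma in_T:
  assumes "\<sigma> \<in> lists {..<k}" "\<And>i. i < length \<sigma> \<Longrightarrow> Phi i i \<noteq> Some (\<sigma> ! i)"
  shows "\<sigma> \<in> T"
proof -
  obtain f where f: "f \<in> DNR k" "map f [0..<length \<sigma>] = \<sigma>"
    using DNR_extension[OF two_le_k assms] by blast
  then have "map f [0..<length \<sigma>] \<in> T"
    unfolding paths_T[symmetric] paths_def by blast
  then show ?thesis unfolding f(2) .
qed

lemma Nil_in_T: "[] \<in> T"
  by (rule in_T) auto

text \<open>Otherwise the leftmost path above \<open>\<sigma>\<close> would be a computable element of \<^term>\<open>DNR k\<close>.\<close>

lemma leaf_extension:
  assumes "\<sigma> \<in> T"
  shows "\<exists>\<rho>. \<sigma> @ \<rho> \<in> leaves T"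
proof (rule ccontr)
  assume no_leaf: "\<nexists>\<rho>. \<sigma> @ \<rho> \<in> leaves T"
  \<comment> \<open>The disjunct \<open>k \<le> i\<close> makes the search total on every string;
    along the constructed path a true child exists, so it never decides the result.\<close>
  define child where "child \<tau> = (LEAST i. \<tau> @ [i] \<in> T \<or> k \<le> i)" for \<tau>
  define s where "s = rec_nat \<sigma> (\<lambda>_ \<tau>. \<tau> @ [child \<tau>])"
  have "s n \<in> T \<and> prefix \<sigma> (s n)" for n
  proof (induction n)
    case 0
    then show ?case using assms by (simp add: s_def)
  next
    case (Suc n)
    then obtain i where i: "s n @ [i] \<in> T"
      using no_leaf unfolding leaves_def by (auto elim!: prefixE)
    then have "child (s n) \<le> i"
      unfolding child_def by (intro Least_le) simp
    then have "child (s n) < k"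
      using snoc_in_T_less[OF i] by simp
    moreover have "s n @ [child (s n)] \<in> T \<or> k \<le> child (s n)"
      unfolding child_def by (rule LeastI[of _ i]) (simp add: i)
    ultimately show ?case using Suc by (simp add: s_def)
  qed
  moreover have prefix: "prefix (s n) (s (Suc n))" for n
    by (simp add: s_def)
  moreover have len: "n \<le> length (s n)" for n
    by (induction n) (auto simp: s_def)
  ultimately have "limit s \<in> DNR k"
    using limit_in_paths[OF is_tree_T] paths_T by blast
  moreover have "computable (\<lambda>g. limit s)"
  proof (rule computable_cong)
    let ?r = "rec_nat (list_encode \<sigma>)
      (\<lambda>_ y. list_encode (list_decode y @ [LEAST i. list_decode y @ [i] \<in> T \<or> k \<le> i]))"
    show "computable (\<lambda>g n. nth_default 0 (list_decode (?r (Suc n))) n)"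
      by (intro computable_intros) auto
    have "s n = list_decode (?r n)" for n
      by (induction n) (simp_all add: s_def child_def)
    moreover have "limit s n = nth_default 0 (s (Suc n)) n" for n
      using len[of "Suc n"] by (simp add: limit_def nth_default_def)
    ultimately show "limit s n = nth_default 0 (list_decode (?r (Suc n))) n" for n
      by simp
  qed
  ultimately show False using DNR_not_computable by blast
qed

text \<open>By compactness, convergence of \<open>\<Phi>\<^sub>e(e)\<close> to a value below \<open>k\<close> can be recognized from the tree
  alone, without simulating the computation.\<close>

definition excludes :: "nat \<Rightarrow> nat \<Rightarrow> nat \<Rightarrow> bool" where
  "excludes e m v \<longleftrightarrow> e < m \<and>
    (\<forall>\<sigma>\<in>lists {..<k}. length \<sigma> = m \<longrightarrow> \<sigma> \<in> T \<longrightarrow> nth_default 0 \<sigma> e \<noteq> v)"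

lemma decidable_excludes [computable_intros]:
  assumes "computable E" "computable M" "computable V"
  shows "decidable (\<lambda>g x. excludes (E g x) (M g x) (V g x))"
  unfolding excludes_def
  by (intro assms computable_comp[OF assms(1)] computable_comp[OF assms(3)] computable_intros)

lemma Phi_eq_Some_iff_excludes:
  assumes "v < k"
  shows "Phi e e = Some v \<longleftrightarrow> (\<exists>m. excludes e m v)"
proof
  assume "\<exists>m. excludes e m v"
  then obtain m where m: "excludes e m v" ..
  show "Phi e e = Some v"
  proof (rule ccontr)
    assume "Phi e e \<noteq> Some v"
    \<comment> \<open>If \<open>v\<close> is permitted at \<open>e\<close>, some element of
      \<open>DNR k\<close> takes it, and its segment of length \<open>m\<close> lies in
      \<open>T\<close>.\<close>
    then obtain f where "f \<in> DNR k" "f e = v"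
      using DNR_nonempty[OF two_le_k] DNR_update[OF _ assms] by (metis all_not_in_conv fun_upd_same)
    then have "map f [0..<m] \<in> T"
      using paths_T unfolding paths_def by blast
    with m T_subset \<open>f e = v\<close> show False
      unfolding excludes_def by (force simp: nth_default_def)
  qed
next
  assume Phi: "Phi e e = Some v"
  show "\<exists>m. excludes e m v"
  proof (rule ccontr)
    assume none: "\<nexists>m. excludes e m v"
    \<comment> \<open>The strings compatible with value \<open>v\<close> at \<open>e\<close>. If no
      level excludes \<open>v\<close>, this subtree is infinite, and Koenig's lemma gives an element
      of \<open>DNR k\<close> with that value.\<close>
    let ?T = "{\<sigma>\<in>T. e < length \<sigma> \<longrightarrow> \<sigma> ! e = v}"
    have "is_tree ?T"
      unfolding is_tree_def by (auto intro: T_prefix elim!: prefixE simp: nth_append)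
    moreover have "?T \<subseteq> lists {..<k}"
      using T_subset by auto
    moreover have "\<exists>\<sigma>\<in>?T. n \<le> length \<sigma>" for n
    proof -
      have "\<not> excludes e (Suc (max e n)) v" using none by blast
      then show ?thesis unfolding excludes_def by (auto simp: nth_default_def)
    qed
    ultimately obtain f where f: "f \<in> paths ?T"
      using koenig[of ?T k] by blast
    then have "f \<in> DNR k"
      using paths_T unfolding paths_def by auto
    moreover have "map f [0..<Suc e] ! e = v"
      using f unfolding paths_def by (auto simp del: upt_Suc)
    ultimately show False
      using Phi by (auto simp: DNR_def simp del: upt_Suc)
  qed
qed

end

section \<open>Hyperconcatenation\<close>

lemma is_tree_hyperconcat_tree: "is_tree (hyperconcat_tree T\<^sub>Q T\<^sub>P)"
  unfolding is_tree_def hyperconcat_tree_def by (blast intro: prefix_order.trans)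

text \<open>This is the case of empty \<open>\<tau>\<close>, where no block is ever
  completed.\<close>

lemma paths_subset_hyperconcat:
  assumes "[] \<in> T\<^sub>Q"
  shows "paths T\<^sub>P \<subseteq> hyperconcat T\<^sub>Q T\<^sub>P"
proof -
  have "T\<^sub>P \<subseteq> hyperconcat_tree T\<^sub>Q T\<^sub>P"
  proof
    fix \<sigma> assume "\<sigma> \<in> T\<^sub>P"
    with assms show "\<sigma> \<in> hyperconcat_tree T\<^sub>Q T\<^sub>P"
      unfolding hyperconcat_tree_def by (intro CollectI exI[of _ "[]"] exI[of _ \<sigma>]) simp
  qed
  then show ?thesis unfolding hyperconcat_def paths_def by blast
qed

lemma leaf_extends_in_hyperconcat:
  assumes "f \<in> paths T\<^sub>Q" "\<rho> \<in> leaves T\<^sub>P" "[] \<in> T\<^sub>P"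
  shows "\<exists>g\<in>hyperconcat T\<^sub>Q T\<^sub>P. prefix \<rho> (map g [0..<Suc (length \<rho>)])"
proof -
  \<comment> \<open>Every block is filled with the same leaf \<open>\<rho>\<close>, and
    \<open>f\<close> supplies the symbols closing the blocks.\<close>
  define s where "s n = concat (map2 (\<lambda>\<rho> i. \<rho> @ [i]) (replicate n \<rho>) (map f [0..<n]))" for n
  have s_Suc: "s (Suc n) = s n @ \<rho> @ [f n]" for n
  proof -
    have "replicate (Suc n) \<rho> = replicate n \<rho> @ [\<rho>]"
      by (simp add: replicate_append_same)
    then show ?thesis by (simp add: s_def del: replicate_Suc)
  qed
  have prefix: "prefix (s n) (s (Suc n))" for n
    by (simp add: s_Suc)
  have len: "n \<le> length (s n)" for n
    by (induction n) (simp_all add: s_Suc)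
  have "s n \<in> hyperconcat_tree T\<^sub>Q T\<^sub>P" for n
    using assms unfolding hyperconcat_tree_def paths_def s_def
    by (intro CollectI exI[of _ "map f [0..<n]"] exI[of _ "replicate n \<rho>"] exI[of _ "[]"])
      (auto simp: in_lists_conv_set)
  then have "limit s \<in> hyperconcat T\<^sub>Q T\<^sub>P"
    unfolding hyperconcat_def
    by (rule limit_in_paths[OF is_tree_hyperconcat_tree _ prefix len])
  moreover have "map (limit s) [0..<Suc (length \<rho>)] = \<rho> @ [f 0]"
    using map_limit_length[of s 1, OF prefix len] by (simp add: s_def)
  ultimately show ?thesis by (metis prefixI)
qed

context DNR_tree
begin

subsection \<open>The reduction\<close>

text \<open>\<open>k * a + b\<close> codes the pairs of values below \<open>k\<close> bijectively by
  the values below \<open>k * k\<close>; \<open>div k\<close> and \<open>mod k\<close> undo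
  it.\<close>

definition op_index :: nat where
  "op_index = (SOME c. \<forall>a b. Phi c (prod_encode (a, b)) = Some (k * a + b))"

lemma Phi_op_index: "Phi op_index (prod_encode (a, b)) = Some (k * a + b)"
proof -
  have "computable (\<lambda>g x. k * fst (prod_decode x) + snd (prod_decode x))"
    by (intro computable_intros)
  from computable_imp_Phi[OF this]
  have "\<exists>c. \<forall>a b. Phi c (prod_encode (a, b)) = Some (k * a + b)"
    by (metis fst_conv prod_encode_inverse snd_conv)
  then show ?thesis unfolding op_index_def by (rule someI2_ex) blast
qed

text \<open>A value of \<open>f \<in> DNR (k\<^sup>2)\<close> at \<open>diag_index op_index d e\<close> is a pair \<open>(hi f d e, lo f d e)\<close> that
  differs from \<open>(\<Phi>\<^sub>d(d), \<Phi>\<^sub>e(e))\<close> in at least one component.\<close>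

definition hi :: "(nat \<Rightarrow> nat) \<Rightarrow> nat \<Rightarrow> nat \<Rightarrow> nat" where
  "hi f d e = f (diag_index op_index d e) div k"

definition lo :: "(nat \<Rightarrow> nat) \<Rightarrow> nat \<Rightarrow> nat \<Rightarrow> nat" where
  "lo f d e = f (diag_index op_index d e) mod k"

lemma k_pos: "0 < k"
  using two_le_k by simp

lemma computable_hi [computable_intros]:
  "computable D \<Longrightarrow> computable E \<Longrightarrow> computable (\<lambda>g x. hi g (D g x) (E g x))"
  unfolding hi_def by (intro computable_intros k_pos)

lemma computable_lo [computable_intros]:
  "computable D \<Longrightarrow> computable E \<Longrightarrow> computable (\<lambda>g x. lo g (D g x) (E g x))"
  unfolding lo_def by (intro computable_intros k_pos)

lemma lo_less: "lo f d e < k"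
  unfolding lo_def using k_pos by simp

lemma hi_less:
  assumes "f \<in> DNR (k\<^sup>2)"
  shows "hi f d e < k"
proof -
  have "f (diag_index op_index d e) < k * k"
    using assms by (simp add: DNR_def power2_eq_square)
  then show ?thesis
    unfolding hi_def by (rule less_mult_imp_div_less)
qed

text \<open>Were both components diagonal values, they would recombine to the value of
  \<open>f\<close> at the index, which would then be the diagonal value there.\<close>

lemma Phi_neq_hi:
  assumes "f \<in> DNR (k\<^sup>2)" "Phi e e = Some (lo f d e)"
  shows "Phi d d \<noteq> Some (hi f d e)"
proof
  assume "Phi d d = Some (hi f d e)"
  from Phi_diag_index[OF this assms(2) Phi_op_index]
  have "Phi (diag_index op_index d e) (diag_index op_index d e) = Some (f (diag_index op_index d e))"
    unfolding hi_def lo_def by simp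
  with assms(1) show False by (simp add: DNR_def)
qed

text \<open>The searches below are total because they also stop when they are not needed.\<close>

definition witness :: "(nat \<Rightarrow> nat) \<Rightarrow> nat \<Rightarrow> nat \<Rightarrow> nat" where
  "witness f d j = fst (prod_decode (LEAST n. map (lo f d) [0..<Suc j] \<in> T \<or>
    excludes (fst (prod_decode n)) (snd (prod_decode n)) (lo f d (fst (prod_decode n)))))"

text \<open>If no value of \<open>lo f d\<close> is excluded, none is diagonal, so all its initial
  segments lie in \<open>T\<close>. As \<open>lo\<close> is always below \<open>k\<close>, this
  holds for arbitrary oracles \<open>f\<close>, as total search requires.\<close>

lemma witness_ex: "\<exists>n. map (lo f d) [0..<Suc j] \<in> T \<or>
    excludes (fst (prod_decode n)) (snd (prod_decode n)) (lo f d (fst (prod_decode n)))"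
proof (rule ccontr)
  assume none: "\<not> ?thesis"
  have "Phi e e \<noteq> Some (lo f d e)" for e
  proof
    assume "Phi e e = Some (lo f d e)"
    then obtain m where "excludes e m (lo f d e)"
      using Phi_eq_Some_iff_excludes[OF lo_less] by blast
    with none show False by (metis fst_conv prod_encode_inverse snd_conv)
  qed
  then have "map (lo f d) [0..<Suc j] \<in> T"
    by (intro in_T) (auto simp: lo_less simp del: upt_Suc)
  with none show False by blast
qed

lemma computable_witness [computable_intros]:
  assumes "computable D" "computable J"
  shows "computable (\<lambda>g x. witness g (D g x) (J g x))"
  unfolding witness_def
  by (intro assms computable_comp[OF assms(1)] computable_comp[OF assms(2)] computable_intros witness_ex)

lemma Phi_witness:
  assumes "map (lo f d) [0..<Suc j] \<notin> T"
  shows "Phi (witness f d j) (witness f d j) = Some (lo f d (witness f d j))"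
  using LeastI_ex[OF witness_ex[of f d j]] assms Phi_eq_Some_iff_excludes[OF lo_less]
  unfolding witness_def by blast

definition leaf_suffix :: "(nat \<Rightarrow> nat) \<Rightarrow> nat \<Rightarrow> nat \<Rightarrow> nat list" where
  "leaf_suffix f d j = list_decode (LEAST n. map (lo f d) [0..<j] @ list_decode n \<in> leaves T \<or>
    map (lo f d) [0..<j] \<notin> T)"

lemma leaf_suffix_ex:
  "\<exists>n. map (lo f d) [0..<j] @ list_decode n \<in> leaves T \<or> map (lo f d) [0..<j] \<notin> T"
  using leaf_extension by (metis list_encode_inverse)

lemma computable_leaf_suffix [computable_intros]:
  assumes "computable D" "computable J"
  shows "computable (\<lambda>g x. list_encode (leaf_suffix g (D g x) (J g x)))"
  unfolding leaf_suffix_def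
  by (intro assms computable_comp[OF assms(1)] computable_comp[OF assms(2)] computable_intros leaf_suffix_ex)

lemma leaf_suffix:
  "map (lo f d) [0..<j] \<in> T \<Longrightarrow> map (lo f d) [0..<j] @ leaf_suffix f d j \<in> leaves T"
  using LeastI_ex[OF leaf_suffix_ex[of f d j]] unfolding leaf_suffix_def by blast

text \<open>In state \<open>(d, j, u)\<close> the reduction has written \<open>u\<close>, which consists of \<open>d\<close> complete blocks, and
  the first \<open>j\<close> values of \<open>lo f d\<close>. As soon as these leave the tree, the current block is completed.\<close>

primrec state :: "(nat \<Rightarrow> nat) \<Rightarrow> nat \<Rightarrow> nat \<times> nat \<times> nat list" where
  "state f 0 = (0, 0, [])"
| "state f (Suc n) = (case state f n of (d, j, u) \<Rightarrow>
    if map (lo f d) [0..<Suc j] \<in> T then (d, Suc j, u)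
    else (Suc d, 0, u @ map (lo f d) [0..<j] @ leaf_suffix f d j @ [hi f d (witness f d j)]))"

definition written :: "(nat \<Rightarrow> nat) \<Rightarrow> nat \<Rightarrow> nat list" where
  "written f n = (case state f n of (d, j, u) \<Rightarrow> u @ map (lo f d) [0..<j])"

text \<open>Completing a block only appends: the entry \<open>lo f d j\<close> that would leave
  \<open>T\<close> is never written.\<close>

lemma prefix_written: "prefix (written f n) (written f (Suc n))"
  by (auto simp: written_def split: prod.splits)

lemma length_written: "n \<le> length (written f n)"
proof (induction n)
  case (Suc n)
  moreover have "length (written f n) < length (written f (Suc n))"
    by (auto simp: written_def split: prod.splits)
  ultimately show ?case by simp
qed simp

definition state_encode :: "nat \<times> nat \<times> nat list \<Rightarrow> nat" where
  "state_encode s = (case s of (d, j, u) \<Rightarrow> prod_encode (d, prod_encode (j, list_encode u)))"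

lemma computable_state: "computable (\<lambda>g x. state_encode (state g x))"
proof (rule computable_cong)
  let ?d = "\<lambda>y. fst (prod_decode y)" and ?j = "\<lambda>y. fst (prod_decode (snd (prod_decode y)))"
  let ?u = "\<lambda>y. list_decode (snd (prod_decode (snd (prod_decode y))))"
  let ?step = "\<lambda>f y. if map (lo f (?d y)) [0..<Suc (?j y)] \<in> T
    then prod_encode (?d y, prod_encode (Suc (?j y), list_encode (?u y)))
    else prod_encode (Suc (?d y), prod_encode (0, list_encode (?u y @ map (lo f (?d y)) [0..<?j y] @
      leaf_suffix f (?d y) (?j y) @ [hi f (?d y) (witness f (?d y) (?j y))])))"
  let ?init = "prod_encode (0, prod_encode (0, list_encode []))"
  show "computable (\<lambda>g x. rec_nat ?init (\<lambda>_ y. ?step g y) x)"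
    by (intro computable_intros)
  have step: "state_encode (state f (Suc n)) = ?step f (state_encode (state f n))" for f n
    by (cases "state f n") (simp add: state_encode_def del: upt_Suc list_encode.simps)
  show "state_encode (state f n) = rec_nat ?init (\<lambda>_ y. ?step f y) n" for f n
  proof (induction n)
    case 0
    then show ?case by (simp add: state_encode_def)
  next
    case (Suc n)
    show ?case unfolding step Suc by (simp only: nat.rec)
  qed
qed

lemma computable_limit_written: "computable (\<lambda>g. limit (written g))"
proof (rule computable_cong)
  let ?d = "\<lambda>y. fst (prod_decode y)" and ?j = "\<lambda>y. fst (prod_decode (snd (prod_decode y)))"
  let ?u = "\<lambda>y. list_decode (snd (prod_decode (snd (prod_decode y))))"
  let ?s = "\<lambda>g n. state_encode (state g (Suc n))"
  have s: "computable ?s"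
    by (intro computable_comp[OF computable_state] computable_intros)
  show "computable (\<lambda>g n. nth_default 0 (?u (?s g n) @ map (lo g (?d (?s g n))) [0..<?j (?s g n)]) n)"
    by (intro s computable_comp[OF s] computable_intros)
  show "limit (written f) n =
      nth_default 0 (?u (?s f n) @ map (lo f (?d (?s f n))) [0..<?j (?s f n)]) n" for f n
  proof -
    have "written f (Suc n) = ?u (?s f n) @ map (lo f (?d (?s f n))) [0..<?j (?s f n)]"
      unfolding written_def state_encode_def by (simp split: prod.split del: state.simps)
    then show ?thesis
      using length_written[of "Suc n" f] by (simp add: limit_def nth_default_def del: state.simps)
  qed
qed

text \<open>The symbols closing the blocks are recorded as avoiding the diagonal, not as a string of
  one tree; by \<open>in_T\<close> they then belong to any corresponding tree, such as
  \<open>T\<^sub>Q\<close>.\<close>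

lemma state_invariant:
  assumes "f \<in> DNR (k\<^sup>2)" "state f n = (d, j, u)"
  shows "map (lo f d) [0..<j] \<in> T \<and> (\<exists>\<tau> \<rho>s. length \<tau> = d \<and> length \<rho>s = d \<and>
    \<tau> \<in> lists {..<k} \<and> (\<forall>i<d. Phi i i \<noteq> Some (\<tau> ! i)) \<and> \<rho>s \<in> lists (leaves T) \<and>
    u = concat (map2 (\<lambda>\<rho> i. \<rho> @ [i]) \<rho>s \<tau>))"
  using assms(2)
proof (induction n arbitrary: d j u)
  case 0
  then show ?case using Nil_in_T by simp
next
  case (Suc n)
  obtain d' j' u' where s: "state f n = (d', j', u')"
    by (cases "state f n")
  from Suc.IH[OF s] obtain \<tau> \<rho>s where IH: "map (lo f d') [0..<j'] \<in> T" "length \<tau> = d'" "length \<rho>s = d'"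
    "\<tau> \<in> lists {..<k}" "\<forall>i<d'. Phi i i \<noteq> Some (\<tau> ! i)" "\<rho>s \<in> lists (leaves T)"
    "u' = concat (map2 (\<lambda>\<rho> i. \<rho> @ [i]) \<rho>s \<tau>)"
    by blast
  show ?case
  proof (cases "map (lo f d') [0..<Suc j'] \<in> T")
    case True
    then have "d = d'" "j = Suc j'" "u = u'"
      using Suc.prems s by (auto simp del: upt_Suc)
    then show ?thesis using True IH by blast
  next
    case False
    let ?\<rho> = "map (lo f d') [0..<j'] @ leaf_suffix f d' j'" and ?i = "hi f d' (witness f d' j')"
    have eq: "d = Suc d'" "j = 0" "u = u' @ ?\<rho> @ [?i]"
      using Suc.prems s False by (auto simp del: upt_Suc)
    have "?\<rho> \<in> leaves T"
      using leaf_suffix[OF IH(1)] .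
    \<comment> \<open>Since \<open>T\<close> was left, \<open>lo f d'\<close> is diagonal at the
      witness, so the paired \<open>hi\<close> value is not the diagonal value at
      \<open>d'\<close>.\<close>
    moreover have "Phi d' d' \<noteq> Some ?i" "?i < k"
      using Phi_neq_hi[OF assms(1) Phi_witness[OF False]] hi_less[OF assms(1)] by auto
    ultimately have "\<exists>\<tau> \<rho>s. length \<tau> = d \<and> length \<rho>s = d \<and>
      \<tau> \<in> lists {..<k} \<and> (\<forall>i<d. Phi i i \<noteq> Some (\<tau> ! i)) \<and> \<rho>s \<in> lists (leaves T) \<and>
      u = concat (map2 (\<lambda>\<rho> i. \<rho> @ [i]) \<rho>s \<tau>)"
      using IH(2-7) eq
      by (intro exI[of _ "\<tau> @ [?i]"] exI[of _ "\<rho>s @ [?\<rho>]"]) (auto simp: nth_append less_Suc_eq)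
    then show ?thesis using Nil_in_T eq by simp
  qed
qed

lemma limit_written_in_hyperconcat:
  assumes "f \<in> DNR (k\<^sup>2)" "DNR_tree k T\<^sub>Q"
  shows "limit (written f) \<in> hyperconcat T\<^sub>Q T"
  unfolding hyperconcat_def
proof (rule limit_in_paths[OF is_tree_hyperconcat_tree _ prefix_written length_written])
  fix n
  obtain d j u where s: "state f n = (d, j, u)"
    by (cases "state f n")
  from state_invariant[OF assms(1) s] obtain \<tau> \<rho>s where "map (lo f d) [0..<j] \<in> T" "length \<rho>s = length \<tau>"
    "\<tau> \<in> lists {..<k}" "\<forall>i<length \<tau>. Phi i i \<noteq> Some (\<tau> ! i)" "\<rho>s \<in> lists (leaves T)"
    "u = concat (map2 (\<lambda>\<rho> i. \<rho> @ [i]) \<rho>s \<tau>)"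
    by metis
  moreover from this have "\<tau> \<in> T\<^sub>Q"
    by (intro DNR_tree.in_T[OF assms(2)]) auto
  ultimately show "written f n \<in> hyperconcat_tree T\<^sub>Q T"
    unfolding hyperconcat_tree_def written_def s
    by (intro CollectI exI[of _ \<tau>] exI[of _ \<rho>s] exI[of _ "map (lo f d) [0..<j]"]) simp
qed

lemma hyperconcat_le_DNR:
  assumes "DNR_tree k T\<^sub>Q"
  shows "hyperconcat T\<^sub>Q T \<le>\<^sub>M DNR (k\<^sup>2)"
proof -
  obtain e where e: "\<And>g x. runs g (code_of e) x (limit (written g) x)"
    using computable_code_of[OF computable_limit_written] by blast
  then have "Phi_oracle e g x = Some (limit (written g) x)" for g x
    unfolding Phi_oracle_eq_Some_iff .
  then have "Phi_functional e g = Some (limit (written g))" for g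
    unfolding Phi_functional_def by simp
  then show ?thesis
    using limit_written_in_hyperconcat[OF _ assms]
    unfolding medvedev_le_def partial_computable_def by blast
qed

subsection \<open>Non-reducibility\<close>

text \<open>Every string of the tree is extendible in the hyperconcatenation, so a single value of a
  functional that is total there can be computed by searching the tree.\<close>

lemma not_DNR_le_hyperconcat:
  assumes "DNR_tree k T\<^sub>Q"
  shows "\<not> DNR m \<le>\<^sub>M hyperconcat T\<^sub>Q T"
proof
  interpret Q: DNR_tree k T\<^sub>Q by fact
  assume "DNR m \<le>\<^sub>M hyperconcat T\<^sub>Q T"
  then obtain e where e: "\<And>g. g \<in> hyperconcat T\<^sub>Q T \<Longrightarrow> \<exists>h\<in>DNR m. Phi_functional e g = Some h"
    unfolding medvedev_le_def partial_computable_def by blast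
  let ?c = "code_of e"
  have total: "\<exists>h\<in>DNR m. \<forall>x. runs g ?c x (h x)" if g: "g \<in> hyperconcat T\<^sub>Q T" for g
  proof -
    obtain h where h: "h \<in> DNR m" "Phi_functional e g = Some h"
      using e[OF g] by blast
    then have "Phi_oracle e g x = Some (h x)" for x
      unfolding Phi_functional_def by (auto split: if_splits)
    then show ?thesis
      using h(1) unfolding Phi_oracle_eq_Some_iff by blast
  qed
  have ex: "\<exists>w. list_decode w \<in> T \<and> 0 < ev ?c (list_decode w) x" for x
  proof -
    \<comment> \<open>A path of \<open>T\<close> belongs to the hyperconcatenation, so the
      functional converges on one of its initial segments.\<close>
    obtain g where g: "g \<in> paths T"
      using DNR_nonempty[OF two_le_k] paths_T by blast
    then obtain y where "runs g ?c x y"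
      using total paths_subset_hyperconcat[OF Q.Nil_in_T] by blast
    from eventually_happens[OF ev_complete[OF this]]
    obtain n where "ev ?c (map g [0..<n]) x = Suc y" by auto
    moreover have "map g [0..<n] \<in> T"
      using g unfolding paths_def by blast
    ultimately show ?thesis by (metis list_encode_inverse zero_less_Suc)
  qed
  define str where "str x = (LEAST w. list_decode w \<in> T \<and> 0 < ev ?c (list_decode w) x)" for x
  have str: "list_decode (str x) \<in> T" "0 < ev ?c (list_decode (str x)) x" for x
    using LeastI_ex[OF ex[of x]] unfolding str_def by auto
  have "computable (\<lambda>g x. str x)"
    unfolding str_def by (intro computable_intros ex)
  then have "computable (\<lambda>g x. ev ?c (list_decode (str x)) x - 1)"
    by (intro computable_intros) simp
  then obtain i where i: "\<And>x. Phi i x = Some (ev ?c (list_decode (str x)) x - 1)"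
    using computable_imp_Phi by blast
  \<comment> \<open>At its own index \<open>i\<close>, the search finds a string on which the
    functional outputs \<open>Phi i i\<close>.\<close>
  let ?\<sigma> = "list_decode (str i)"
  \<comment> \<open>\<open>?\<sigma>\<close> need not lie on a path of \<open>T\<close>, but through
    a leaf it continues to an element of the hyperconcatenation.\<close>
  obtain \<rho> where \<rho>: "?\<sigma> @ \<rho> \<in> leaves T"
    using leaf_extension[OF str(1)] by blast
  moreover obtain f where "f \<in> paths T\<^sub>Q"
    using DNR_nonempty[OF two_le_k] Q.paths_T by blast
  ultimately obtain g where g: "g \<in> hyperconcat T\<^sub>Q T"
    and prefix: "prefix (?\<sigma> @ \<rho>) (map g [0..<Suc (length (?\<sigma> @ \<rho>))])"
    using leaf_extends_in_hyperconcat[OF _ _ Nil_in_T] by blast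
  have "?\<sigma> ! j = g j" if "j < length ?\<sigma>" for j
  proof -
    obtain \<upsilon> where "map g [0..<Suc (length (?\<sigma> @ \<rho>))] = ?\<sigma> @ \<rho> @ \<upsilon>"
      using prefix by (auto elim!: prefixE simp del: upt_Suc)
    then have "map g [0..<Suc (length (?\<sigma> @ \<rho>))] ! j = ?\<sigma> ! j"
      using that by (simp only: nth_append if_True)
    then show ?thesis using that by (simp del: upt_Suc)
  qed
  then have "runs g ?c i (ev ?c ?\<sigma> i - 1)"
    using str(2)[of i] by (intro ev_sound) auto
  moreover obtain h where h: "h \<in> DNR m" "runs g ?c i (h i)"
    using total[OF g] by blast
  ultimately have "Phi i i = Some (h i)"
    unfolding i by (simp add: runs_deterministic)
  with h(1) show False
    unfolding DNR_def by blast
qed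

end

theorem theorem71:
  fixes k :: nat and T\<^sub>Q T\<^sub>P :: "nat list set"
  assumes "2 \<le> k"
    and "corresponding_tree k (DNR k) T\<^sub>Q"
    and "corresponding_tree k (DNR k) T\<^sub>P"
  shows "hyperconcat T\<^sub>Q T\<^sub>P <\<^sub>M DNR (k ^ 2)"
proof -
  interpret P: DNR_tree k T\<^sub>P by unfold_locales (fact assms)+
  have "DNR_tree k T\<^sub>Q" by unfold_locales (fact assms)+
  then show ?thesis
    unfolding medvedev_less_def using P.hyperconcat_le_DNR P.not_DNR_le_hyperconcat by blast
qed

end
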